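(* Let $r>0$, $\underline{p}_1\in[-r,0]$, $\overline{p}_1\in[0,r]$, and let $\underline{p}_2\le \overline{p}_2$ be real numbers. Then the Minkowski sum of $\mathcal{X}(\underline{p}_1,\overline{p}_1,r)$ and $\mathcal{X}(\underline{p}_2,\overline{p}_2)$ is $$\mathcal{X}(\underline{p}_1,\overline{p}_1,r)\oplus\mathcal{X}(\underline{p}_2,\overline{p}_2)=\Big\{[P,Q]^{\mathsf T}:\ \underline{p}_1+\underline{p}_2\le P\le \overline{p}_1+\overline{p}_2,\ -g(P)\le Q\le g(P)\Big\},$$ where $g$ is a concave function (on $[\underline{p}_1+\underline{p}_2,\overline{p}_1+\overline{p}_2]$) given by $$g(P):=\begin{cases} r, & P\in[\underline{p}_2,\overline{p}_2],\\ \sqrt{r^2-(P-\underline{p}_2)^2}, & P\in[\underline{p}_1+\underline{p}_2,\underline{p}_2),\\ \sqrt{r^2-(P-\overline{p}_2)^2}, & P\in(\overline{p}_2,\overline{p}_1+\overline{p}_2].\end{cases}$$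
   Context: For real $\underline{p},\overline{p}$ and $r>0$ define the subsets of $\mathbb{R}^2$ $$\mathcal{X}(\underline{p},\overline{p},r):=\{[P,Q]^{\mathsf T}:\ \underline{p}\le P\le\overline{p},\ P^2+Q^2\le r^2\},\qquad \mathcal{X}(\underline{p},\overline{p}):=\{[P,Q]^{\mathsf T}:\ \underline{p}\le P\le\overline{p},\ Q=0\}.$$ $\mathcal{X}_1\oplus\mathcal{X}_2$ denotes the Minkowski sum. Convention: an interval $[a,b)$ or $(a,b]$ with $a>b$ is the empty set. *)

theory Defs
  imports "HOL-Analysis.Analysis" "HOL-Library.Set_Algebras"
begin

definition disc_slice :: "real \<Rightarrow> real \<Rightarrow> real \<Rightarrow> (real^2) set" where
  "disc_slice pl pu r = {vector [P, Q] | P Q. pl \<le> P \<and> P \<le> pu \<and> P\<^sup>2 + Q\<^sup>2 \<le> r\<^sup>2}"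

definition axis_segment :: "real \<Rightarrow> real \<Rightarrow> (real^2) set" where
  "axis_segment pl pu = {vector [P, Q] | P Q. pl \<le> P \<and> P \<le> pu \<and> Q = 0}"

(* The piecewise function is only meaningful on {pl1 + pl2 .. pu1 + pu2};
   its value elsewhere is left unspecified. *)
definition q_bound :: "real \<Rightarrow> real \<Rightarrow> real \<Rightarrow> real \<Rightarrow> real \<Rightarrow> real \<Rightarrow> real" where
  "q_bound r pl1 pu1 pl2 pu2 P =
     (if P \<in> {pl2..pu2} then r
      else if P \<in> {pl1 + pl2..<pl2} then sqrt (r\<^sup>2 - (P - pl2)\<^sup>2)
      else if P \<in> {pu2<..pu1 + pu2} then sqrt (r\<^sup>2 - (P - pu2)\<^sup>2)
      else undefined)"

end

theory Submission
  imports Defs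
begin

text \<open>
  A point \<open>(P, Q)\<close> lies in the Minkowski sum iff some \<open>t \<in> [pl2, pu2]\<close> makes \<open>(P - t, Q)\<close> a point
  of the disc slice. The best choice of \<open>t\<close> is the point of \<open>[pl2, pu2]\<close> nearest to \<open>P\<close>: it
  minimises \<open>(P - t)\<^sup>2\<close>, and for \<open>pl1 + pl2 \<le> P \<le> pu1 + pu2\<close> it respects the bounds
  \<open>pl1 \<le> P - t \<le> pu1\<close> because \<open>pl1 \<le> 0 \<le> pu1\<close>. The distance from \<open>P\<close> to that point is \<open>0\<close>, \<open>pl2 - P\<close> or \<open>P - pu2\<close>, so the
  condition left on \<open>Q\<close>, namely \<open>Q\<^sup>2 \<le> r\<^sup>2 - (P - t)\<^sup>2\<close>, is \<open>\<bar>Q\<bar> \<le> g P\<close> with the three branches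
  of the function \<open>g\<close>, that is \<open>q_bound\<close>.

  Concavity needs no computation with these branches. Both summands are convex, hence so is their
  sum. The points \<open>(P, g P)\<close> belong to the sum, so chords of the graph of \<open>g\<close> do too, and the set
  equality says that points of the sum lie below the graph.
\<close>

lemma plane_vector_eq_iff: "v = vector [P, Q] \<longleftrightarrow> v $ 1 = P \<and> v $ 2 = (Q :: real)"
  for v :: "real^2"
  by (simp add: vec_eq_iff forall_2)

lemma mem_disc_slice_iff:
  "v \<in> disc_slice pl pu r \<longleftrightarrow> pl \<le> v $ 1 \<and> v $ 1 \<le> pu \<and> (v $ 1)\<^sup>2 + (v $ 2)\<^sup>2 \<le> r\<^sup>2"
  by (auto simp: disc_slice_def plane_vector_eq_iff)

lemma mem_axis_segment_iff: "v \<in> axis_segment pl pu \<longleftrightarrow> pl \<le> v $ 1 \<and> v $ 1 \<le> pu \<and> v $ 2 = 0"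
  by (auto simp: axis_segment_def plane_vector_eq_iff)

lemma convex_coordinate_strip: "convex {v :: real^'n. a \<le> v $ i \<and> v $ i \<le> b}"
proof -
  have "{v :: real^'n. a \<le> v $ i \<and> v $ i \<le> b} = (\<lambda>v. v $ i) -` {a..b}"
    by auto
  then show ?thesis
    by (simp add: convex_linear_vimage bounded_linear.linear bounded_linear_vec_nth)
qed

lemma convex_disc_slice:
  assumes "0 \<le> r"
  shows "convex (disc_slice pl pu r)"
proof -
  have "(norm v)\<^sup>2 = (v $ 1)\<^sup>2 + (v $ 2)\<^sup>2" for v :: "real^2"
    unfolding power2_norm_eq_inner by (simp add: inner_vec_def sum_2 power2_eq_square)
  then have "(v $ 1)\<^sup>2 + (v $ 2)\<^sup>2 \<le> r\<^sup>2 \<longleftrightarrow> norm v \<le> r" for v :: "real^2"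
    using assms by (metis abs_le_square_iff abs_norm_cancel abs_of_nonneg)
  then have "disc_slice pl pu r = {v. pl \<le> v $ 1 \<and> v $ 1 \<le> pu} \<inter> cball 0 r"
    by (auto simp: mem_disc_slice_iff)
  then show ?thesis
    by (simp add: convex_Int convex_coordinate_strip)
qed

lemma convex_axis_segment: "convex (axis_segment pl pu)"
proof -
  have "axis_segment pl pu = {v. pl \<le> v $ 1 \<and> v $ 1 \<le> pu} \<inter> {v. 0 \<le> v $ 2 \<and> v $ 2 \<le> 0}"
    by (auto simp: mem_axis_segment_iff)
  then show ?thesis
    by (simp only: convex_Int convex_coordinate_strip)
qed

lemma mem_disc_slice_plus_axis_segment_iff:
  "v \<in> disc_slice pl1 pu1 r + axis_segment pl2 pu2 \<longleftrightarrow>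
     (\<exists>t\<in>{pl2..pu2}. pl1 \<le> v $ 1 - t \<and> v $ 1 - t \<le> pu1 \<and> (v $ 1 - t)\<^sup>2 + (v $ 2)\<^sup>2 \<le> r\<^sup>2)"
proof
  assume "v \<in> disc_slice pl1 pu1 r + axis_segment pl2 pu2"
  then obtain a b where "a \<in> disc_slice pl1 pu1 r" "b \<in> axis_segment pl2 pu2" "v = a + b"
    by (elim set_plus_elim)
  then show "\<exists>t\<in>{pl2..pu2}. pl1 \<le> v $ 1 - t \<and> v $ 1 - t \<le> pu1 \<and> (v $ 1 - t)\<^sup>2 + (v $ 2)\<^sup>2 \<le> r\<^sup>2"
    by (intro bexI[of _ "b $ 1"]) (auto simp: mem_disc_slice_iff mem_axis_segment_iff)
next
  assume "\<exists>t\<in>{pl2..pu2}. pl1 \<le> v $ 1 - t \<and> v $ 1 - t \<le> pu1 \<and> (v $ 1 - t)\<^sup>2 + (v $ 2)\<^sup>2 \<le> r\<^sup>2"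
  then obtain t where t: "t \<in> {pl2..pu2}" "pl1 \<le> v $ 1 - t" "v $ 1 - t \<le> pu1"
    "(v $ 1 - t)\<^sup>2 + (v $ 2)\<^sup>2 \<le> r\<^sup>2"
    by blast
  have "vector [v $ 1 - t, v $ 2] \<in> disc_slice pl1 pu1 r" "vector [t, 0] \<in> axis_segment pl2 pu2"
    using t by (auto simp: mem_disc_slice_iff mem_axis_segment_iff)
  moreover have "v = vector [v $ 1 - t, v $ 2] + vector [t, 0]"
    by (simp add: vec_eq_iff forall_2)
  ultimately show "v \<in> disc_slice pl1 pu1 r + axis_segment pl2 pu2"
    by (metis set_plus_intro)
qed

text \<open>
  The term \<open>max pl2 (min pu2 P)\<close> is the point of \<open>[pl2, pu2]\<close> nearest to \<open>P\<close>; it turns the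
  three branches into one formula.
\<close>

lemma q_bound_eq_sqrt_nearest:
  assumes "0 \<le> r" "pl2 \<le> pu2" "pl1 + pl2 \<le> P" "P \<le> pu1 + pu2"
  shows "q_bound r pl1 pu1 pl2 pu2 P = sqrt (r\<^sup>2 - (P - max pl2 (min pu2 P))\<^sup>2)"
  using assms by (auto simp: q_bound_def max_def min_def)

lemma nearest_point_of_interval_minimises:
  fixes P :: real
  assumes "t \<in> {a..b}"
  shows "(P - max a (min b P))\<^sup>2 \<le> (P - t)\<^sup>2"
  using assms by (auto simp: abs_le_square_iff[symmetric] max_def min_def)

text \<open>
  The parameter \<open>t\<close> can be eliminated because the nearest point of \<open>[pl2, pu2]\<close> satisfies every
  constraint that any other choice satisfies. The signs of \<open>pl1\<close> and \<open>pu1\<close> matter here: without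
  them, \<open>P\<close> itself could lie in \<open>[pl2, pu2]\<close> while the slice contains no point with first
  coordinate \<open>0\<close>.
\<close>

lemma mem_sum_iff_abs_le_q_bound:
  assumes r: "0 \<le> r" and pl1: "pl1 \<in> {-r..0}" and pu1: "pu1 \<in> {0..r}" and le: "pl2 \<le> pu2"
  shows "v \<in> disc_slice pl1 pu1 r + axis_segment pl2 pu2 \<longleftrightarrow>
           pl1 + pl2 \<le> v $ 1 \<and> v $ 1 \<le> pu1 + pu2 \<and> \<bar>v $ 2\<bar> \<le> q_bound r pl1 pu1 pl2 pu2 (v $ 1)"
    (is "?L \<longleftrightarrow> ?R")
proof -
  define P where "P = v $ 1"
  define s where "s = max pl2 (min pu2 P)"
  have abs_le_iff: "\<bar>v $ 2\<bar> \<le> q_bound r pl1 pu1 pl2 pu2 P \<longleftrightarrow> (P - s)\<^sup>2 + (v $ 2)\<^sup>2 \<le> r\<^sup>2"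
    if "pl1 + pl2 \<le> P" "P \<le> pu1 + pu2"
  proof -
    have "(v $ 2)\<^sup>2 \<le> r\<^sup>2 - (P - s)\<^sup>2 \<longleftrightarrow> \<bar>v $ 2\<bar> \<le> sqrt (r\<^sup>2 - (P - s)\<^sup>2)"
      by (metis real_sqrt_abs real_sqrt_le_iff)
    then show ?thesis
      using q_bound_eq_sqrt_nearest[OF r le that] by (auto simp: s_def)
  qed
  show ?thesis
  proof
    assume ?L
    then obtain t where t: "t \<in> {pl2..pu2}" "pl1 \<le> P - t" "P - t \<le> pu1"
      "(P - t)\<^sup>2 + (v $ 2)\<^sup>2 \<le> r\<^sup>2"
      by (auto simp: mem_disc_slice_plus_axis_segment_iff P_def)
    have bounds: "pl1 + pl2 \<le> P" "P \<le> pu1 + pu2"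
      using t by auto
    moreover have "(P - s)\<^sup>2 + (v $ 2)\<^sup>2 \<le> r\<^sup>2"
      using nearest_point_of_interval_minimises[OF t(1), of P] t(4) by (simp add: s_def)
    ultimately show ?R
      using abs_le_iff by (simp add: P_def)
  next
    assume R: ?R
    then have "(P - s)\<^sup>2 + (v $ 2)\<^sup>2 \<le> r\<^sup>2"
      using abs_le_iff by (simp add: P_def)
    moreover have "s \<in> {pl2..pu2}" "pl1 \<le> P - s" "P - s \<le> pu1"
      using R pl1 pu1 le by (auto simp: s_def P_def max_def min_def)
    ultimately show ?L
      by (auto simp: mem_disc_slice_plus_axis_segment_iff P_def)
  qed
qed

lemma q_bound_nonneg:
  assumes r: "0 \<le> r" and pl1: "pl1 \<in> {-r..0}" and pu1: "pu1 \<in> {0..r}" and le: "pl2 \<le> pu2"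
    and P: "pl1 + pl2 \<le> P" "P \<le> pu1 + pu2"
  shows "0 \<le> q_bound r pl1 pu1 pl2 pu2 P"
proof -
  have "\<bar>P - max pl2 (min pu2 P)\<bar> \<le> \<bar>r\<bar>"
    using assms by (auto simp: max_def min_def)
  then show ?thesis
    unfolding q_bound_eq_sqrt_nearest[OF r le P] by (simp add: abs_le_square_iff)
qed

text \<open>
  The graph of \<open>q_bound\<close> is the upper boundary of a convex set: a convex combination of two graph
  points stays in the Minkowski sum, and there its second coordinate is at most \<open>q_bound\<close>.
\<close>

lemma concave_on_q_bound:
  assumes r: "0 \<le> r" and pl1: "pl1 \<in> {-r..0}" and pu1: "pu1 \<in> {0..r}" and le: "pl2 \<le> pu2"
  shows "concave_on {pl1 + pl2..pu1 + pu2} (q_bound r pl1 pu1 pl2 pu2)"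
proof -
  define g where "g = q_bound r pl1 pu1 pl2 pu2"
  define S where "S = disc_slice pl1 pu1 r + axis_segment pl2 pu2"
  have "convex S"
    unfolding S_def by (intro convex_set_plus convex_disc_slice convex_axis_segment r)
  have mem_S_iff: "v \<in> S \<longleftrightarrow> pl1 + pl2 \<le> v $ 1 \<and> v $ 1 \<le> pu1 + pu2 \<and> \<bar>v $ 2\<bar> \<le> g (v $ 1)" for v
    unfolding S_def g_def by (rule mem_sum_iff_abs_le_q_bound[OF assms])
  have graph_point: "vector [x, g x] \<in> S" if "x \<in> {pl1 + pl2..pu1 + pu2}" for x
    using that q_bound_nonneg[OF assms, of x] by (auto simp: mem_S_iff g_def)
  have "u * g x + w * g y \<le> g (u * x + w * y)"
    if "x \<in> {pl1 + pl2..pu1 + pu2}" "y \<in> {pl1 + pl2..pu1 + pu2}" "0 \<le> u" "0 \<le> w" "u + w = 1"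
    for x y u w
  proof -
    have "u *\<^sub>R vector [x, g x] + w *\<^sub>R vector [y, g y] \<in> S"
      using that by (intro convexD[OF \<open>convex S\<close>] graph_point)
    then show ?thesis
      by (simp add: mem_S_iff abs_le_iff)
  qed
  then show ?thesis
    unfolding g_def[symmetric] by (simp add: concave_on_iff)
qed

theorem proposition1:
  fixes r pl1 pu1 pl2 pu2 :: real
  assumes "r > 0"
    and "pl1 \<in> {-r..0}"
    and "pu1 \<in> {0..r}"
    and "pl2 \<le> pu2"
  shows "disc_slice pl1 pu1 r + axis_segment pl2 pu2 =
           {vector [P, Q] | P Q. pl1 + pl2 \<le> P \<and> P \<le> pu1 + pu2 \<and>
              - q_bound r pl1 pu1 pl2 pu2 P \<le> Q \<and> Q \<le> q_bound r pl1 pu1 pl2 pu2 P} \<and>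
         concave_on {pl1 + pl2..pu1 + pu2} (q_bound r pl1 pu1 pl2 pu2)"
proof -
  have r: "0 \<le> r"
    using assms(1) by simp
  show ?thesis
    using concave_on_q_bound[OF r assms(2-4)]
    by (auto simp: set_eq_iff mem_sum_iff_abs_le_q_bound[OF r assms(2-4)] plane_vector_eq_iff
        abs_le_iff)
qed

end
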